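(* The numbers $a(n,m)$ satisfy the recurrence $$a(n,m)=\sum_{j=1}^{n-m}\left(\binom{j+m-1}{j}-1\right)a(n-m,j),\qquad n\ge2,\quad 1\le m\le n-1,$$ with $a(n,n)=1$ for all $n\ge1$.
   Context: For a positive integer $n$, $\mathcal{L}_n$ denotes the set of all words $a=(a_1,a_2,\ldots,a_n)$ over the alphabet of non-negative integers satisfying: (i) $a_{i+1}\ge a_i-1$ for $1\le i<n$; and (ii) if $a_i=k>0$ with $i$ minimal (i.e. $i$ is the position of the left-most occurrence of the letter $k$), then there exist $i_1<i<i_2$ such that $a_{i_1}=a_{i_2}=k-1$. For $1\le m\le n$, $a(n,m)$ is the number of words in $\mathcal{L}_n$ containing exactly $m$ zeros. *)

theory Defs
  imports Main
begin

text \<open>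
  Words are lists of naturals, so the letter \<open>a\<^sub>i\<close> of the paper is \<open>a ! (i - 1)\<close>.
  Condition (i) is stated without subtraction, so that truncation on \<open>nat\<close> plays no role.
\<close>

definition leftmost_occurrence :: "nat list \<Rightarrow> nat \<Rightarrow> bool" where
  "leftmost_occurrence a i \<longleftrightarrow> i < length a \<and> (\<forall>j<i. a ! j \<noteq> a ! i)"

definition L :: "nat \<Rightarrow> nat list set" where
  "L n = {a. length a = n \<and>
     (\<forall>i. i + 1 < n \<longrightarrow> a ! i \<le> a ! (i + 1) + 1) \<and>
     (\<forall>i k. leftmost_occurrence a i \<and> a ! i = k \<and> k > 0 \<longrightarrow>
        (\<exists>i1 i2. i1 < i \<and> i < i2 \<and> i2 < n \<and> a ! i1 = k - 1 \<and> a ! i2 = k - 1))}"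

text \<open>
  The letters of a word in \<open>L n\<close> are smaller than \<open>n\<close>, so \<open>L n\<close> is finite and the
  cardinality below is a genuine count.
\<close>

lemma L_letter_le: "a \<in> L n \<Longrightarrow> i < n \<Longrightarrow> a ! i \<le> i"
proof (induction i rule: less_induct)
  case (less i)
  have len: "length a = n" using less.prems(1) by (simp add: L_def)
  show ?case
  proof (cases "leftmost_occurrence a i \<and> a ! i > 0")
    case True
    then obtain i1 where "i1 < i" "a ! i1 = a ! i - 1"
      using less.prems(1) unfolding L_def by blast
    then show ?thesis using less.IH[of i1] less.prems by fastforce
  next
    case False
    then consider "a ! i = 0" | j where "j < i" "a ! j = a ! i"
      using less.prems(2) len unfolding leftmost_occurrence_def by auto
    then show ?thesis using less.IH less.prems by cases fastforce+
  qed
qed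

lemma finite_L: "finite (L n)"
proof (rule finite_subset)
  show "L n \<subseteq> {a. set a \<subseteq> {..n} \<and> length a = n}"
    using L_letter_le by (fastforce simp: L_def in_set_conv_nth)
  show "finite {a :: nat list. set a \<subseteq> {..n} \<and> length a = n}"
    by (rule finite_lists_length_eq) simp
qed

definition a_num :: "nat \<Rightarrow> nat \<Rightarrow> nat" where
  "a_num n m = card {a \<in> L n. count_list a 0 = m}"

end

theory Submission
  imports Defs
begin

text \<open>
  Delete the zeros of a word \<open>a\<close> and lower every other letter by one. Both conditions
  defining \<open>L\<close> survive, so the result is a word \<open>b \<in> L (n - m)\<close>, where \<open>m\<close> is the number of
  deleted zeros. The recurrence counts the fibres of this map according to the number
  \<open>j\<close> of zeros of \<open>b\<close>, that is, of ones of \<open>a\<close>.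

  To recover \<open>a\<close>, insert \<open>m\<close> zeros into \<open>c = map Suc b\<close>. A zero may only be preceded by a letter
  \<open>0\<close> or \<open>1\<close>, so the zeros are distributed over \<open>j + 1\<close> slots: one at the front and one
  after each \<open>1\<close> (\<open>card_zero_insertions\<close>). The condition on the left-most occurrence of a letter
  \<open>k \<ge> 2\<close> only concerns the letters of \<open>c\<close> and is inherited from \<open>b\<close>. The condition for
  \<open>k = 1\<close> concerns the first letter of \<open>c\<close>, because \<open>b\<close> starts with \<open>0\<close>; it asks for a zero in
  the front slot and for a zero in some other slot. Once one zero is put in front, the
  other \<open>m - 1\<close> can be placed in \<open>(j + m - 1) choose j\<close> ways, and exactly one of these
  leaves all zeros in front (\<open>card_fibre\<close>).
\<close>

section \<open>The defining conditions as list predicates\<close>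

abbreviation descends_slowly :: "nat list \<Rightarrow> bool" where
  "descends_slowly \<equiv> successively (\<lambda>x y. x \<le> Suc y)"

text \<open>
  The first occurrence of \<open>Suc k\<close> sits at the head of the \<open>dropWhile\<close> part; as it differs from
  \<open>k\<close>, it does no harm that this part contains it. This form commutes with \<open>map\<close> and \<open>filter\<close>,
  which statements about positions do not.
\<close>

definition straddles :: "nat \<Rightarrow> nat list \<Rightarrow> bool" where
  "straddles k a \<longleftrightarrow> (Suc k \<in> set a \<longrightarrow>
     k \<in> set (takeWhile (\<lambda>x. x \<noteq> Suc k) a) \<and> k \<in> set (dropWhile (\<lambda>x. x \<noteq> Suc k) a))"

lemma straddles_append:
  assumes "Suc k \<notin> set xs"
  shows "straddles k (xs @ Suc k # ys) \<longleftrightarrow> k \<in> set xs \<and> k \<in> set ys"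
proof -
  have "takeWhile (\<lambda>x. x \<noteq> Suc k) (xs @ Suc k # ys) = xs"
       "dropWhile (\<lambda>x. x \<noteq> Suc k) (xs @ Suc k # ys) = Suc k # ys"
    using assms by (auto simp: takeWhile_append dropWhile_append)
  then show ?thesis by (simp add: straddles_def)
qed

lemma first_split_unique:
  assumes "xs @ y # ys = us @ y # vs" "y \<notin> set xs" "y \<notin> set us"
  shows "xs = us \<and> ys = vs"
  using assms by (auto simp: append_eq_append_conv2 Cons_eq_append_conv append_eq_Cons_conv)

lemma leftmost_occurrence_iff:
  "leftmost_occurrence a i \<longleftrightarrow>
     (\<exists>xs ys. a = xs @ a ! i # ys \<and> length xs = i \<and> a ! i \<notin> set xs)"
proof
  assume l: "leftmost_occurrence a i"
  then have "a = take i a @ a ! i # drop (Suc i) a"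
    by (intro id_take_nth_drop) (simp add: leftmost_occurrence_def)
  moreover have "length (take i a) = i" "a ! i \<notin> set (take i a)"
    using l by (auto simp: leftmost_occurrence_def in_set_conv_nth)
  ultimately show "\<exists>xs ys. a = xs @ a ! i # ys \<and> length xs = i \<and> a ! i \<notin> set xs" by blast
next
  assume "\<exists>xs ys. a = xs @ a ! i # ys \<and> length xs = i \<and> a ! i \<notin> set xs"
  then obtain xs y ys where a: "a = xs @ y # ys" and i: "length xs = i" and y: "y \<notin> set xs"
    by metis
  have "a ! i = y" using a i by auto
  moreover have "a ! j \<noteq> y" if "j < i" for j
    using that a i y nth_mem[of j xs] by (auto simp: nth_append)
  ultimately show "leftmost_occurrence a i"
    using a i by (auto simp: leftmost_occurrence_def)
qed

lemma straddles_iff_leftmost_occurrence: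
  "straddles k a \<longleftrightarrow>
     (\<forall>i. leftmost_occurrence a i \<and> a ! i = Suc k \<longrightarrow>
        (\<exists>i1 i2. i1 < i \<and> i < i2 \<and> i2 < length a \<and> a ! i1 = k \<and> a ! i2 = k))"
    (is "_ \<longleftrightarrow> ?R")
proof (cases "Suc k \<in> set a")
  case False
  moreover have "\<not> (leftmost_occurrence a i \<and> a ! i = Suc k)" for i
    using False by (metis leftmost_occurrence_def nth_mem)
  ultimately show ?thesis by (auto simp: straddles_def)
next
  case True
  then obtain xs ys where a: "a = xs @ Suc k # ys" and xs: "Suc k \<notin> set xs"
    by (meson split_list_first)
  have leftmost: "leftmost_occurrence a i \<and> a ! i = Suc k \<longleftrightarrow> i = length xs" for i
  proof
    assume "leftmost_occurrence a i \<and> a ! i = Suc k"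
    then obtain us vs where "a = us @ Suc k # vs" "length us = i" "Suc k \<notin> set us"
      unfolding leftmost_occurrence_iff by metis
    then show "i = length xs"
      using a xs first_split_unique by metis
  next
    assume "i = length xs"
    then show "leftmost_occurrence a i \<and> a ! i = Suc k"
      using a xs unfolding leftmost_occurrence_iff by auto
  qed
  have before: "k \<in> set xs \<longleftrightarrow> (\<exists>i<length xs. a ! i = k)"
    by (auto simp: a in_set_conv_nth nth_append)
  have after: "k \<in> set ys \<longleftrightarrow> (\<exists>i>length xs. i < length a \<and> a ! i = k)"
  proof
    assume "k \<in> set ys"
    then obtain i where "i < length ys" "ys ! i = k" by (auto simp: in_set_conv_nth)
    then show "\<exists>i>length xs. i < length a \<and> a ! i = k"
      by (intro exI[of _ "length xs + Suc i"]) (simp add: a nth_append)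
  next
    assume "\<exists>i>length xs. i < length a \<and> a ! i = k"
    then obtain d where d: "length xs + Suc d < length a" "a ! (length xs + Suc d) = k"
      by (metis add_Suc_right less_imp_Suc_add)
    have "ys ! d = k"
      using d(2) by (simp only: a nth_append_length_plus nth_Cons_Suc)
    moreover have "d < length ys" using d(1) by (simp add: a)
    ultimately show "k \<in> set ys" by auto
  qed
  have "straddles k a \<longleftrightarrow> k \<in> set xs \<and> k \<in> set ys"
    unfolding a using xs by (rule straddles_append)
  also have "\<dots> \<longleftrightarrow> ?R"
    unfolding before after leftmost by auto
  finally show ?thesis .
qed

lemma L_iff:
  "a \<in> L n \<longleftrightarrow> length a = n \<and> descends_slowly a \<and> (\<forall>k. straddles k a)"
proof -
  have "(\<forall>i k. leftmost_occurrence a i \<and> a ! i = k \<and> k > 0 \<longrightarrow>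
        (\<exists>i1 i2. i1 < i \<and> i < i2 \<and> i2 < length a \<and> a ! i1 = k - 1 \<and> a ! i2 = k - 1))
      \<longleftrightarrow> (\<forall>k. straddles k a)" (is "?L \<longleftrightarrow> ?R")
  proof
    assume ?L
    show ?R
      unfolding straddles_iff_leftmost_occurrence
    proof (intro allI impI)
      fix k i
      assume "leftmost_occurrence a i \<and> a ! i = Suc k"
      then show "\<exists>i1 i2. i1 < i \<and> i < i2 \<and> i2 < length a \<and> a ! i1 = k \<and> a ! i2 = k"
        using \<open>?L\<close>[rule_format, of i "Suc k"] by simp
    qed
  next
    assume ?R
    show ?L
    proof (intro allI impI)
      fix i k
      assume *: "leftmost_occurrence a i \<and> a ! i = k \<and> k > 0"
      then show "\<exists>i1 i2. i1 < i \<and> i < i2 \<and> i2 < length a \<and> a ! i1 = k - 1 \<and> a ! i2 = k - 1"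
        using \<open>?R\<close>[unfolded straddles_iff_leftmost_occurrence, rule_format, of i "k - 1"] by simp
    qed
  qed
  moreover have "descends_slowly a \<longleftrightarrow> (\<forall>i. i + 1 < length a \<longrightarrow> a ! i \<le> a ! (i + 1) + 1)"
    by (auto simp: successively_conv_nth)
  ultimately show ?thesis unfolding L_def by auto
qed

section \<open>Deleting the zeros\<close>

definition shrink :: "nat list \<Rightarrow> nat list" where
  "shrink a = map (\<lambda>x. x - 1) (filter (\<lambda>x. x \<noteq> 0) a)"

lemma map_Suc_shrink: "map Suc (shrink a) = filter (\<lambda>x. x \<noteq> 0) a"
  by (induction a) (auto simp: shrink_def)

lemma shrink_eq_iff: "shrink a = b \<longleftrightarrow> filter (\<lambda>x. x \<noteq> 0) a = map Suc b"
  by (metis map_Suc_shrink inj_map_eq_map inj_Suc)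

lemma length_filter_nonzero:
  "length (filter (\<lambda>x. x \<noteq> 0) a) + count_list a (0::nat) = length a"
  by (induction a) auto

lemma length_shrink: "length (shrink a) + count_list a 0 = length a"
  using length_filter_nonzero[of a] by (simp add: shrink_def)

lemma descends_slowly_map_Suc [simp]:
  "descends_slowly (map Suc b) \<longleftrightarrow> descends_slowly b"
  by (simp add: successively_map)

text \<open>
  New neighbours \<open>x\<close>, \<open>y\<close> arise where a block of zeros between them is deleted. Then \<open>x\<close> was
  followed by \<open>0\<close>, so \<open>x = 1\<close> and no \<open>y\<close> is too small.
\<close>

lemma descends_slowly_filter:
  "descends_slowly a \<Longrightarrow> descends_slowly (filter (\<lambda>x. x \<noteq> 0) a)"
proof (induction a)
  case (Cons x a)
  then show ?case
    by (cases a) (auto simp: successively_Cons)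
qed simp

lemma descends_slowly_shrink: "descends_slowly a \<Longrightarrow> descends_slowly (shrink a)"
  by (metis descends_slowly_filter descends_slowly_map_Suc map_Suc_shrink)

lemma straddles_map_Suc: "straddles (Suc k) (map Suc b) \<longleftrightarrow> straddles k b"
  by (auto simp: straddles_def takeWhile_map dropWhile_map comp_def)

lemma straddles_filter_nonzero:
  "straddles (Suc k) (filter (\<lambda>x. x \<noteq> 0) a) \<longleftrightarrow> straddles (Suc k) a"
proof -
  have "takeWhile (\<lambda>x. x \<noteq> Suc (Suc k)) (filter (\<lambda>x. x \<noteq> 0) a)
      = filter (\<lambda>x. x \<noteq> 0) (takeWhile (\<lambda>x. x \<noteq> Suc (Suc k)) a)"
    by (induction a) auto
  moreover have "dropWhile (\<lambda>x. x \<noteq> Suc (Suc k)) (filter (\<lambda>x. x \<noteq> 0) a)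
      = filter (\<lambda>x. x \<noteq> 0) (dropWhile (\<lambda>x. x \<noteq> Suc (Suc k)) a)"
    by (induction a) auto
  ultimately show ?thesis by (simp add: straddles_def)
qed

lemma straddles_shrink: "straddles k (shrink a) \<longleftrightarrow> straddles (Suc k) a"
  by (metis map_Suc_shrink straddles_filter_nonzero straddles_map_Suc)

text \<open>
  The condition at a letter \<open>k \<ge> 2\<close> of \<open>a\<close> is the condition at \<open>k - 1\<close> in the reduced word.
  The bound on descents has to be kept for \<open>a\<close> itself, because it restricts where the deleted
  zeros can stand.
\<close>

lemma L_iff_shrink:
  "a \<in> L n \<longleftrightarrow>
     length a = n \<and> descends_slowly a \<and> straddles 0 a \<and> shrink a \<in> L (n - count_list a 0)"
proof -
  have "(\<forall>k. straddles k a) \<longleftrightarrow> straddles 0 a \<and> (\<forall>k. straddles k (shrink a))"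
    unfolding straddles_shrink by (metis not0_implies_Suc)
  then show ?thesis
    using length_shrink[of a] descends_slowly_shrink[of a] by (auto simp: L_iff)
qed

section \<open>Inserting zeros\<close>

definition zero_insertions :: "nat list \<Rightarrow> nat \<Rightarrow> nat list set" where
  "zero_insertions c m =
     {w. descends_slowly w \<and> filter (\<lambda>x. x \<noteq> 0) w = c \<and> count_list w 0 = m}"

definition inner_zero_insertions :: "nat list \<Rightarrow> nat \<Rightarrow> nat list set" where
  "inner_zero_insertions c m = {w \<in> zero_insertions c m. \<not> (\<exists>v. w = 0 # v)}"

lemma finite_zero_insertions: "finite (zero_insertions c m)"
proof (rule finite_subset)
  show "zero_insertions c m \<subseteq> {w. set w \<subseteq> insert 0 (set c) \<and> length w = length c + m}"
    using length_filter_nonzero by (auto simp: zero_insertions_def)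
  show "finite {w. set w \<subseteq> insert 0 (set c) \<and> length w = length c + m}"
    by (rule finite_lists_length_eq) simp
qed

lemma finite_inner_zero_insertions: "finite (inner_zero_insertions c m)"
  using finite_zero_insertions by (simp add: inner_zero_insertions_def)

lemma zero_insertions_0:
  assumes "descends_slowly c" "0 \<notin> set c"
  shows "zero_insertions c 0 = {c}"
proof -
  have "filter (\<lambda>x. x \<noteq> 0) w = w" if "count_list w (0::nat) = 0" for w
    using that by (induction w) (auto split: if_splits)
  moreover have "count_list c 0 = 0" using assms(2) by (simp add: count_list_0_iff)
  ultimately show ?thesis using assms(1) by (auto simp: zero_insertions_def)
qed

lemma zero_insertions_Suc:
  "zero_insertions c (Suc m) = (#) 0 ` zero_insertions c m \<union> inner_zero_insertions c (Suc m)"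
  by (auto simp: zero_insertions_def inner_zero_insertions_def successively_Cons)

lemma zero_Cons_zero_insertions:
  "{w \<in> zero_insertions c (Suc m). \<exists>v. w = 0 # v} = (#) 0 ` zero_insertions c m"
  by (auto simp: zero_insertions_def successively_Cons)

lemma inner_zero_insertions_Nil: "inner_zero_insertions [] m = (if m = 0 then {[]} else {})"
proof -
  have "w = []" if "filter (\<lambda>x. x \<noteq> 0) w = []" "\<not> (\<exists>v. w = 0 # v)" for w :: "nat list"
    using that by (cases w) (auto split: if_splits)
  then have "inner_zero_insertions [] m \<subseteq> {[]}"
    unfolding inner_zero_insertions_def zero_insertions_def by blast
  then show ?thesis by (auto simp: inner_zero_insertions_def zero_insertions_def)
qed

lemma inner_zero_insertions_Cons:
  assumes "x > 0"
  shows "inner_zero_insertions (x # c) m =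
    (#) x ` {w. descends_slowly (x # w) \<and> w \<in> zero_insertions c m}"
  (is "?L = ?R")
proof
  show "?R \<subseteq> ?L"
    using assms by (auto simp: inner_zero_insertions_def zero_insertions_def)
  show "?L \<subseteq> ?R"
  proof
    fix w assume w: "w \<in> ?L"
    then obtain y v where "w = y # v" "y \<noteq> 0"
      by (cases w) (auto simp: inner_zero_insertions_def zero_insertions_def)
    then show "w \<in> ?R"
      using w by (auto simp: inner_zero_insertions_def zero_insertions_def successively_Cons)
  qed
qed

lemma inner_zero_insertions_Cons_1:
  "inner_zero_insertions (1 # c) m = (#) 1 ` zero_insertions c m"
  unfolding inner_zero_insertions_Cons[OF zero_less_one]
  by (auto simp: zero_insertions_def successively_Cons)

lemma inner_zero_insertions_Cons_ge_2:
  assumes "x \<ge> 2" "descends_slowly (x # c)"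
  shows "inner_zero_insertions (x # c) m = (#) x ` inner_zero_insertions c m"
proof -
  have "descends_slowly (x # w) \<longleftrightarrow> \<not> (\<exists>v. w = 0 # v)" if "w \<in> zero_insertions c m" for w
  proof (cases w)
    case (Cons y v)
    then show ?thesis
      using that assms by (cases y) (auto simp: zero_insertions_def successively_Cons)
  qed simp
  then have "{w. descends_slowly (x # w) \<and> w \<in> zero_insertions c m} = inner_zero_insertions c m"
    by (auto simp: inner_zero_insertions_def)
  moreover have "x > 0" using assms(1) by simp
  ultimately show ?thesis by (simp only: inner_zero_insertions_Cons)
qed

text \<open>
  The values are the numbers of weak compositions of \<open>m\<close> into \<open>j\<close> and into \<open>j + 1\<close> parts, where
  \<open>j\<close> is the number of ones of \<open>c\<close>. They are proved together: scanning \<open>c\<close> from the left, the slot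
  behind a \<open>1\<close> turns into a front slot of the remaining word, while a letter \<open>x \<ge> 2\<close>
  allows no zero behind it. Passing from \<open>j\<close> to \<open>j + 1\<close> parts is Pascal's rule. Truncated
  subtraction gives the right values for \<open>j = 0\<close>, namely \<open>1\<close> if \<open>m = 0\<close> and \<open>0\<close> otherwise.
\<close>

lemma card_inner_zero_insertions_and_card_zero_insertions:
  assumes "descends_slowly c" "0 \<notin> set c"
  shows "card (inner_zero_insertions c m) = (count_list c 1 + m - 1) choose m"
    and "card (zero_insertions c m) = (count_list c 1 + m) choose m"
proof -
  have zero_insertions_if_inner: "card (zero_insertions c m) = (count_list c 1 + m) choose m"
    if "descends_slowly c" "0 \<notin> set c"
      and inner: "\<And>m. card (inner_zero_insertions c m) = (count_list c 1 + m - 1) choose m"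
    for c m
  proof (induction m)
    case 0
    then show ?case using that by (simp add: zero_insertions_0)
  next
    case (Suc m)
    have "card (zero_insertions c (Suc m))
        = card ((#) 0 ` zero_insertions c m) + card (inner_zero_insertions c (Suc m))"
      unfolding zero_insertions_Suc
      by (rule card_Un_disjoint)
        (auto simp: finite_zero_insertions finite_inner_zero_insertions inner_zero_insertions_def)
    then show ?case by (simp add: card_image Suc inner)
  qed
  have "card (inner_zero_insertions c m) = (count_list c 1 + m - 1) choose m" for m
    using assms
  proof (induction c arbitrary: m)
    case Nil
    then show ?case by (simp add: inner_zero_insertions_Nil)
  next
    case (Cons x c)
    have c: "descends_slowly c" "0 \<notin> set c"
      using Cons.prems by (auto simp: successively_Cons)
    show ?case
    proof (cases "x = 1")
      case True
      have "card (inner_zero_insertions (x # c) m) = card (zero_insertions c m)"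
        unfolding True inner_zero_insertions_Cons_1 by (simp add: card_image)
      also have "\<dots> = (count_list c 1 + m) choose m"
        using c Cons.IH by (intro zero_insertions_if_inner) auto
      finally show ?thesis by (simp add: True)
    next
      case False
      then have "x \<ge> 2" using Cons.prems by (cases x) auto
      then have "card (inner_zero_insertions (x # c) m) = card (inner_zero_insertions c m)"
        using Cons.prems by (simp add: inner_zero_insertions_Cons_ge_2 card_image)
      then show ?thesis using Cons.IH c False by simp
    qed
  qed
  then show "card (inner_zero_insertions c m) = (count_list c 1 + m - 1) choose m"
    and "card (zero_insertions c m) = (count_list c 1 + m) choose m"
    using zero_insertions_if_inner assms by blast+
qed

lemmas card_zero_insertions = card_inner_zero_insertions_and_card_zero_insertions(2)

section \<open>The fibres\<close>

lemma count_list_map_Suc [simp]: "count_list (map Suc b) (Suc x) = count_list b x"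
  by (simp add: count_list_map_conv)

lemma count_list_replicate_same [simp]: "count_list (replicate n x) x = n"
  by (induction n) auto

lemma replicate_0_in_zero_insertions:
  assumes "descends_slowly c" "0 \<notin> set c"
  shows "replicate m 0 @ c \<in> zero_insertions c m"
  using assms
  by (induction m) (auto simp: zero_insertions_0 zero_insertions_Suc)

text \<open>
  The only insertion that puts no zero behind the first \<open>1\<close> is the one with all \<open>m\<close> zeros in
  front. It is listed explicitly because exactly this word is subtracted when counting.
\<close>

lemma straddles_0_iff:
  assumes w: "w \<in> zero_insertions (1 # c) m" and c: "0 \<notin> set c"
  shows "straddles 0 w \<longleftrightarrow> (\<exists>v. w = 0 # v) \<and> w \<noteq> replicate m 0 @ 1 # c"
proof -
  have "filter (\<lambda>x. x \<noteq> 0) w = 1 # c"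
    using w by (simp add: zero_insertions_def)
  then obtain us vs
    where uv: "w = us @ 1 # vs" "\<forall>u\<in>set us. u = 0" "filter (\<lambda>x. x \<noteq> 0) vs = c"
    unfolding filter_eq_Cons_iff by metis
  define i where "i = length us"
  have us: "us = replicate i 0"
    using uv(2) by (simp add: i_def replicate_length_same)
  have m: "i + count_list vs 0 = m"
    using w uv(1) by (simp add: zero_insertions_def us)
  have "straddles 0 w \<longleftrightarrow> 0 \<in> set us \<and> 0 \<in> set vs"
    using straddles_append[of 0 us vs] us uv(1) by simp
  moreover have "0 \<in> set us \<longleftrightarrow> (\<exists>v. w = 0 # v)"
    using uv(1) us by (cases i) auto
  moreover have "0 \<notin> set vs \<longleftrightarrow> w = replicate m 0 @ 1 # c"
  proof
    assume "0 \<notin> set vs"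
    then have "i = m" using m by simp
    moreover have "filter (\<lambda>x. x \<noteq> 0) vs = vs"
      using \<open>0 \<notin> set vs\<close> by (intro filter_True) metis
    then have "vs = c" using uv(3) by metis
    ultimately show "w = replicate m 0 @ 1 # c" using uv(1) us by simp
  next
    assume e: "w = replicate m 0 @ 1 # c"
    have "us = replicate m 0 \<and> vs = c"
      using e uv(1) us by (intro first_split_unique[where y = 1]) auto
    then show "0 \<notin> set vs" using c by simp
  qed
  ultimately show ?thesis by blast
qed

lemma L_Cons_0:
  assumes "b \<in> L n" "n > 0"
  obtains b' where "b = 0 # b'"
proof (cases b)
  case Nil
  then show ?thesis using assms by (simp add: L_def)
next
  case (Cons x b')
  then show ?thesis using L_letter_le[OF assms] that by simp
qed

text \<open>
  A word of the fibre has a leading zero, which may be stripped; the rest is any insertion of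
  \<open>m - 1\<close> zeros other than the one with all zeros in front.
\<close>

lemma card_fibre:
  assumes b: "b \<in> L (n - m)" and m: "1 \<le> m" "m < n"
  shows "card {a \<in> L n. count_list a 0 = m \<and> shrink a = b}
       = ((count_list b 0 + m - 1) choose count_list b 0) - 1"
proof -
  obtain b' where b': "b = 0 # b'" using L_Cons_0[OF b] m by auto
  obtain m' where m': "m = Suc m'" using m by (cases m) auto
  let ?c = "map Suc b"
  have c: "descends_slowly ?c" "0 \<notin> set ?c"
    using b by (auto simp: L_iff)
  have len: "length a = n" if "a \<in> zero_insertions ?c m" for a
    using that length_filter_nonzero[of a] b m by (auto simp: zero_insertions_def L_iff)
  have "a \<in> L n \<and> count_list a 0 = m \<and> shrink a = b \<longleftrightarrow>
      a \<in> zero_insertions ?c m \<and> straddles 0 a" for a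
    using b len[of a] unfolding L_iff_shrink[of a n] zero_insertions_def shrink_eq_iff[symmetric]
    by auto
  then have "{a \<in> L n. count_list a 0 = m \<and> shrink a = b}
      = {a \<in> zero_insertions ?c m. straddles 0 a}"
    by blast
  also have "\<dots> = {a \<in> zero_insertions ?c m. \<exists>v. a = 0 # v} - {replicate m 0 @ ?c}"
    using straddles_0_iff[of _ "map Suc b'" m] by (auto simp: b')
  also have "\<dots> = (#) 0 ` zero_insertions ?c m' - {replicate m 0 @ ?c}"
    unfolding m' zero_Cons_zero_insertions ..
  also have "card \<dots> = card (zero_insertions ?c m') - 1"
    using replicate_0_in_zero_insertions[OF c, of m']
    by (subst card_Diff_singleton) (auto simp: m' card_image)
  also have "card (zero_insertions ?c m') = (count_list b 0 + m') choose m'"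
    using card_zero_insertions[OF c, of m'] by simp
  also have "\<dots> = (count_list b 0 + m - 1) choose count_list b 0"
    using binomial_symmetric[of m' "count_list b 0 + m'"] by (simp add: m')
  finally show ?thesis .
qed

section \<open>The recurrence\<close>

lemma a_num_recurrence:
  assumes m: "1 \<le> m" "m < n"
  shows "a_num n m = (\<Sum>j = 1..n - m. (((j + m - 1) choose j) - 1) * a_num (n - m) j)"
proof -
  let ?A = "{a \<in> L n. count_list a 0 = m}"
  let ?f = "\<lambda>j. ((j + m - 1) choose j) - 1"
  have "shrink a \<in> L (n - m)" if "a \<in> L n" "count_list a 0 = m" for a
    using that L_iff_shrink by metis
  then have fibres: "?A = (\<Union>b\<in>L (n - m). {a \<in> L n. count_list a 0 = m \<and> shrink a = b})"
    by blast
  have "a_num n m = (\<Sum>b\<in>L (n - m). card {a \<in> L n. count_list a 0 = m \<and> shrink a = b})"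
    unfolding a_num_def by (subst fibres, rule card_UN_disjoint) (auto simp: finite_L)
  also have "\<dots> = (\<Sum>b\<in>L (n - m). ?f (count_list b 0))"
    using m by (intro sum.cong refl card_fibre)
  also have "\<dots> = (\<Sum>j = 1..n - m. \<Sum>b | b \<in> L (n - m) \<and> count_list b 0 = j. ?f (count_list b 0))"
  proof (rule sum.group[symmetric])
    show "(\<lambda>b. count_list b 0) ` L (n - m) \<subseteq> {1..n - m}"
    proof (rule image_subsetI)
      fix b assume b: "b \<in> L (n - m)"
      obtain b' where "b = 0 # b'" using L_Cons_0[OF b] m by auto
      moreover have "count_list b 0 \<le> n - m"
        using count_le_length[of b 0] b by (simp add: L_iff)
      ultimately show "count_list b 0 \<in> {1..n - m}" by simp
    qed
  qed (auto simp: finite_L)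
  also have "\<dots> = (\<Sum>j = 1..n - m. ?f j * a_num (n - m) j)"
    by (intro sum.cong refl) (simp add: a_num_def)
  finally show ?thesis .
qed

lemma a_num_diagonal: "a_num n n = 1"
proof -
  have "replicate n 0 \<in> L n"
    by (auto simp: L_iff straddles_def successively_conv_nth)
  moreover have "a = replicate n 0" if "a \<in> L n" "count_list a 0 = n" for a
  proof -
    have "filter (\<lambda>x. x \<noteq> 0) a = []"
      using that length_filter_nonzero[of a] by (simp add: L_iff)
    then show ?thesis
      using that(1) by (auto simp: L_iff filter_empty_conv intro: replicate_eqI)
  qed
  moreover have "count_list (replicate n 0) 0 = n" by simp
  ultimately have "{a \<in> L n. count_list a 0 = n} = {replicate n 0}"
    by blast
  then show ?thesis by (simp add: a_num_def)
qed

theorem corollary2p2: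
  shows "(\<forall>n m :: nat. n \<ge> 2 \<and> 1 \<le> m \<and> m \<le> n - 1 \<longrightarrow>
            int (a_num n m) =
              (\<Sum>j = 1..n - m. (int ((j + m - 1) choose j) - 1) * int (a_num (n - m) j)))
       \<and> (\<forall>n :: nat. n \<ge> 1 \<longrightarrow> a_num n n = 1)"
proof (intro conjI allI impI)
  fix n m :: nat
  assume nm: "n \<ge> 2 \<and> 1 \<le> m \<and> m \<le> n - 1"
  have "int (((j + m - 1) choose j) - 1) = int ((j + m - 1) choose j) - 1" for j
  proof -
    have "(j + m - 1) choose j > 0" using nm by (intro zero_less_binomial) auto
    then show ?thesis by linarith
  qed
  moreover have "1 \<le> m" "m < n" using nm by auto
  ultimately show "int (a_num n m) =
      (\<Sum>j = 1..n - m. (int ((j + m - 1) choose j) - 1) * int (a_num (n - m) j))"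
    by (simp add: a_num_recurrence)
next
  fix n :: nat
  show "a_num n n = 1" by (rule a_num_diagonal)
qed

end
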